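(* Let $Q\in\mathbb{F}_q[x]$ be an irreducible polynomial and let $\mathfrak{D}=\deg Q-1$. Then \[ \frac{1}{\phi(Q)}\sum_{\chi\neq\chi_{0}}L\left(\tfrac{1}{2},\chi\right)=1+O\left(q^{-\mathfrak{D}/2}\right), \] where the sum is over all nontrivial Dirichlet characters $\chi$ modulo $Q$, and the implied constant depends at most on $q$.
   Context: $\mathbb{F}_q$ is a fixed finite field with $q$ elements and $\mathcal{A}=\mathbb{F}_q[x]$. For nonzero $N\in\mathcal{A}$, $|N|=q^{\deg N}$. $\phi(Q)=\#(\mathcal{A}/Q\mathcal{A})^{*}$. A Dirichlet character modulo $Q$ is a function $\chi:\mathcal{A}\to\mathbb{C}$ with $\chi(A+BQ)=\chi(A)$ and $\chi(AB)=\chi(A)\chi(B)$ for all $A,B\in\mathcal{A}$, and $\chi(A)\neq0$ if and only if $(A,Q)=1$; $\chi_0$ is the trivial character ($\chi_0(A)=1$ whenever $(A,Q)=1$). The L-function is $L(s,\chi)=\sum_{N\text{ monic}}\chi(N)|N|^{-s}$ for $\Re(s)>1$. For $\chi\neq\chi_0$ one has $\sum_{N\text{ monic},\,\deg N=n}\chi(N)=0$ for $n\ge\deg Q$, so $L(s,\chi)$ is a polynomial in $q^{-s}$, which gives its value for all $s$; in particular $L(\tfrac12,\chi)=\sum_{n=0}^{\deg Q-1}q^{-n/2}\sum_{N\text{ monic},\,\deg N=n}\chi(N)$. *)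

theory Defs
  imports "HOL-Analysis.Analysis" "HOL-Computational_Algebra.Computational_Algebra"
begin

definition poly_abs :: "'a::finite_field poly \<Rightarrow> real" where
  "poly_abs N = (if N = 0 then 0 else real CARD('a) ^ degree N)"

definition monic_polys :: "'a::finite_field poly set" where
  "monic_polys = {N. lead_coeff N = 1}"

text \<open>The number of units of the quotient ring modulo \<open>Q\<close>: the elements of the
  quotient set below are the residue classes that are invertible.\<close>

definition poly_totient :: "'a::finite_field poly \<Rightarrow> nat" where
  "poly_totient Q = card ({A. \<exists>B. Q dvd A * B - 1} // {(A, B). Q dvd A - B})"

definition dirichlet_char :: "'a::finite_field poly \<Rightarrow> ('a poly \<Rightarrow> complex) \<Rightarrow> bool" where
  "dirichlet_char Q \<psi> \<longleftrightarrow>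
     (\<forall>A B. \<psi> (A + B * Q) = \<psi> A) \<and>
     (\<forall>A B. \<psi> (A * B) = \<psi> A * \<psi> B) \<and>
     (\<forall>A. \<psi> A \<noteq> 0 \<longleftrightarrow> coprime A Q)"

definition trivial_char :: "'a::finite_field poly \<Rightarrow> 'a poly \<Rightarrow> complex" where
  "trivial_char Q A = (if coprime A Q then 1 else 0)"

definition dirichlet_L_series :: "('a::finite_field poly \<Rightarrow> complex) \<Rightarrow> complex \<Rightarrow> complex" where
  "dirichlet_L_series \<psi> s =
     (\<Sum>\<^sub>\<infinity>N\<in>monic_polys. \<psi> N * complex_of_real (poly_abs N) powr (- s))"

text \<open>For a nontrivial Dirichlet character the series is, on \<open>Re s > 1\<close>, a polynomial in
  \<open>q powr (- s)\<close>. That polynomial is unique, since \<open>q powr (- s)\<close> takes infinitely many values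
  there, and it gives the value of the L-function at every \<open>s\<close>. For the trivial character there
  is no such polynomial and \<open>dirichlet_L\<close> is unspecified.\<close>

definition dirichlet_L_poly :: "('a::finite_field poly \<Rightarrow> complex) \<Rightarrow> complex poly" where
  "dirichlet_L_poly \<psi> =
     (THE P. \<forall>s. Re s > 1 \<longrightarrow> dirichlet_L_series \<psi> s = poly P (of_nat CARD('a) powr (- s)))"

definition dirichlet_L :: "complex \<Rightarrow> ('a::finite_field poly \<Rightarrow> complex) \<Rightarrow> complex" where
  "dirichlet_L s \<psi> = poly (dirichlet_L_poly \<psi>) (of_nat CARD('a) powr (- s))"

end

(* Summing over all characters modulo Q, orthogonality leaves only the monic N of degree
   < deg Q with N = 1 mod Q, i.e. N = 1, so the sum over all characters of the truncated
   L-polynomials at 1/2 is exactly phi(Q).  The trivial character contributes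
   sum_{k < deg Q} q^(k/2), which is phi(Q) O(q^(-deg Q / 2)).
   The characters are obtained explicitly as A |-> z^(dlog A), z^phi(Q) = 1, from a generator of
   the multiplicative group of the residue field. *)
theory Submission
  imports "HOL-Algebra.Multiplicative_Group" Defs
begin

hide_const (open) UnivPoly.coeff UnivPoly.monom

section \<open>Counting polynomials\<close>

text \<open>The value of \<open>dirichlet_L\<close> at 1/2 is reached only through a polynomial that
  represents the series on Re s > 1. Before any averaging, each nontrivial character therefore needs
  two facts: its series there equals the truncated sum over degrees below \<open>degree Q\<close>,
  and no other polynomial represents it. The first uses absolute convergence to split off the tail,
  and a symmetry that makes the tail vanish. For the trivial character the truncated sum is not the
  L-function; it is merely a finite sum that is added and then subtracted so that orthogonality
  applies to the full set of characters. The explicit form of the characters makes this set finite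
  and reduces orthogonality to a sum of powers of roots of unity. The error turns out to be exactly
  -1 / ((sqrt q - 1) (q^(deg Q / 2) + 1)), which is where the constant 1 / (sqrt q - 1) comes
  from.\<close>

lemma polys_below_Suc:
  "{p :: 'a::zero poly. \<forall>i\<ge>Suc n. poly.coeff p i = 0}
     = (\<lambda>(a, p). pCons a p) ` (UNIV \<times> {p. \<forall>i\<ge>n. poly.coeff p i = 0})"
proof (intro equalityI subsetI)
  fix p :: "'a poly"
  assume p: "p \<in> {p. \<forall>i\<ge>Suc n. poly.coeff p i = 0}"
  obtain a r where [simp]: "p = pCons a r"
    by (cases p)
  have "\<forall>i\<ge>n. poly.coeff r i = 0"
    using p by (force dest: spec[where x = "Suc _"])
  then show "p \<in> (\<lambda>(a, p). pCons a p) ` (UNIV \<times> {p. \<forall>i\<ge>n. poly.coeff p i = 0})"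
    by auto
qed (auto simp: coeff_pCons split: nat.splits)

text \<open>The condition is on coefficients rather than \<open>degree p < n\<close> because
  \<open>degree 0 = 0\<close>: with the degree, the case n = 0 would lose the zero polynomial and
  the count would fail.\<close>

lemma finite_card_polys_below:
  "finite {p :: 'a::{finite,zero} poly. \<forall>i\<ge>n. poly.coeff p i = 0} \<and>
   card {p :: 'a poly. \<forall>i\<ge>n. poly.coeff p i = 0} = CARD('a) ^ n"
proof (induction n)
  case 0
  have "{p :: 'a poly. \<forall>i\<ge>0. poly.coeff p i = 0} = {0}"
    by (auto simp: poly_eq_iff)
  then show ?case
    by simp
next
  case (Suc n)
  have "inj_on (\<lambda>(a :: 'a, p). pCons a p) (UNIV \<times> {p. \<forall>i\<ge>n. poly.coeff p i = 0})"
    by (auto simp: inj_on_def)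
  with Suc show ?case
    unfolding polys_below_Suc by (auto simp: card_image card_cartesian_product)
qed

lemma coeff_zero_ge_iff:
  "(\<forall>i\<ge>n. poly.coeff p i = 0) \<longleftrightarrow> p = 0 \<or> degree p < n"
  by (metis coeff_0 coeff_eq_0 leading_coeff_0_iff not_le order_less_le_trans)

lemma monic_degree_eq:
  "{N \<in> monic_polys. degree N = n}
     = (\<lambda>p. p + Polynomial.monom 1 n) ` {p :: 'a::finite_field poly. \<forall>i\<ge>n. poly.coeff p i = 0}"
proof (intro equalityI subsetI)
  fix N :: "'a poly"
  assume N: "N \<in> {N \<in> monic_polys. degree N = n}"
  have "\<forall>i\<ge>n. poly.coeff (N - Polynomial.monom 1 n) i = 0"
    using N by (auto simp: monic_polys_def coeff_eq_0)
  then show "N \<in> (\<lambda>p. p + Polynomial.monom 1 n) ` {p. \<forall>i\<ge>n. poly.coeff p i = 0}"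
    by (intro image_eqI[where x = "N - Polynomial.monom 1 n"]) auto
next
  fix N :: "'a poly"
  assume "N \<in> (\<lambda>p. p + Polynomial.monom 1 n) ` {p. \<forall>i\<ge>n. poly.coeff p i = 0}"
  then obtain p where p: "\<forall>i\<ge>n. poly.coeff p i = 0" and N: "N = p + Polynomial.monom 1 n"
    by auto
  have "poly.coeff N n = 1" "\<And>i. i > n \<Longrightarrow> poly.coeff N i = 0"
    using p N by auto
  then have "degree N = n"
    by (metis le_degree coeff_0 degree_le linorder_not_less nle_le zero_neq_one)
  with \<open>poly.coeff N n = 1\<close> show "N \<in> {N \<in> monic_polys. degree N = n}"
    by (auto simp: monic_polys_def)
qed

lemma finite_monic_degree: "finite {N \<in> monic_polys :: 'a::finite_field poly set. degree N = n}"
  unfolding monic_degree_eq using finite_card_polys_below by blast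

lemma card_monic_degree:
  "card {N \<in> monic_polys :: 'a::finite_field poly set. degree N = n} = CARD('a) ^ n"
  unfolding monic_degree_eq using finite_card_polys_below[where 'a = 'a and n = n]
  by (subst card_image) (auto simp: inj_on_def)

lemma finite_monic_degree_less:
  "finite {N \<in> monic_polys :: 'a::finite_field poly set. degree N < n}"
proof -
  have "{N \<in> monic_polys :: 'a poly set. degree N < n} = (\<Union>k<n. {N \<in> monic_polys. degree N = k})"
    by auto
  then show ?thesis
    by (simp add: finite_monic_degree)
qed

text \<open>The general semiring serves two uses: real \<open>t\<close> in the summability bound and
  complex \<open>t\<close> for the contribution of the trivial character.\<close>

lemma sum_monic_degree_less:
  fixes t :: "'b::{comm_semiring_1}"
  shows "(\<Sum>N \<in> {N \<in> monic_polys :: 'a::finite_field poly set. degree N < n}. t ^ degree N)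
           = (\<Sum>k<n. (of_nat CARD('a) * t) ^ k)"
proof -
  have "(\<Sum>N \<in> {N \<in> monic_polys :: 'a poly set. degree N < n}. t ^ degree N)
      = (\<Sum>k<n. \<Sum>N \<in> {N \<in> {N \<in> monic_polys :: 'a poly set. degree N < n}. degree N = k}. t ^ degree N)"
    by (rule sum.group[symmetric]) (auto simp: finite_monic_degree_less)
  also have "\<dots> = (\<Sum>k<n. \<Sum>N \<in> {N \<in> monic_polys :: 'a poly set. degree N = k}. t ^ k)"
    by (intro sum.cong) auto
  finally show ?thesis
    by (simp add: card_monic_degree power_mult_distrib)
qed

text \<open>There are q^k monic polynomials of degree k, so every finite partial sum is dominated by
  B times the geometric series of ratio q |t|.\<close>

lemma abs_summable_on_monic:
  fixes f :: "'a::finite_field poly \<Rightarrow> complex"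
  assumes f: "\<And>N. cmod (f N) \<le> B" and t: "real CARD('a) * cmod t < 1"
  shows "(\<lambda>N. norm (f N * t ^ degree N)) summable_on monic_polys"
proof (rule nonneg_bounded_partial_sums_imp_summable_on)
  let ?x = "real CARD('a) * cmod t"
  have B: "B \<ge> 0"
    using f[of 0] norm_ge_zero order_trans by blast
  show "\<forall>\<^sub>F X in finite_subsets_at_top (monic_polys :: 'a poly set).
          (\<Sum>N\<in>X. cmod (f N * t ^ degree N)) \<le> B * (1 / (1 - ?x))"
  proof (rule eventually_finite_subsets_at_top_weakI)
    fix X :: "'a poly set"
    assume X: "finite X" "X \<subseteq> monic_polys"
    \<comment> \<open>For empty \<open>X\<close> the maximum is unspecified, but the inclusion below
      is then trivial.\<close>
    define n where "n = Suc (Max (degree ` X))"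
    have sub: "X \<subseteq> {N \<in> monic_polys. degree N < n}"
      using X by (auto simp: n_def less_Suc_eq_le)
    have "(\<Sum>N\<in>X. cmod (f N * t ^ degree N)) \<le> (\<Sum>N\<in>X. B * cmod t ^ degree N)"
      by (intro sum_mono) (auto simp: norm_mult norm_power intro!: mult_right_mono f)
    also have "\<dots> \<le> (\<Sum>N\<in>{N \<in> monic_polys :: 'a poly set. degree N < n}. B * cmod t ^ degree N)"
      by (rule sum_mono2) (use sub B in \<open>auto simp: finite_monic_degree_less\<close>)
    also have "\<dots> = B * (\<Sum>k<n. ?x ^ k)"
      by (simp add: sum_distrib_left[symmetric] sum_monic_degree_less)
    also have "(\<Sum>k<n. ?x ^ k) \<le> (\<Sum>k. ?x ^ k)"
      using t by (intro sum_le_suminf summable_geometric) auto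
    also have "\<dots> = 1 / (1 - ?x)"
      using t by (intro suminf_geometric) auto
    finally show "(\<Sum>N\<in>X. cmod (f N * t ^ degree N)) \<le> B * (1 / (1 - ?x))"
      using B by (simp add: mult_left_mono)
  qed
qed auto

text \<open>Multiplication by a primitive root \<open>w\<close> permutes the roots of unity and
  multiplies the sum by \<open>w ^ k\<close>, which differs from 1 for 0 < k < m.\<close>

lemma sum_roots_unity_power:
  assumes "k < m"
  shows "(\<Sum>z | z ^ m = 1. z ^ k) = (if k = 0 then of_nat m else (0::complex))"
proof (cases "k = 0")
  case True
  then show ?thesis
    using assms card_roots_unity_eq[of m] by simp
next
  case False
  define w where "w = cis (2 * pi / real m)"
  have m: "m > 0"
    using assms by simp
  have w_pow: "w ^ j = cis (2 * pi * real j / real m)" for j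
    unfolding w_def Complex.DeMoivre by (simp add: mult_ac)
  have "w ^ m = 1"
    using m by (simp add: w_pow)
  have "w ^ k \<noteq> w ^ 0"
    unfolding w_pow
    using inj_onD[OF bij_betw_imp_inj_on[OF Complex.bij_betw_roots_unity[OF m]], of k 0] False assms
    by auto
  have "w \<noteq> 0"
    by (simp add: w_def)
  have "bij_betw (\<lambda>z. w * z) {z. z ^ m = 1} {z. z ^ m = 1}"
    using \<open>w ^ m = 1\<close> \<open>w \<noteq> 0\<close>
    by (intro bij_betw_byWitness[where f' = "\<lambda>z. z / w"]) (auto simp: power_mult_distrib power_divide)
  then have "(\<Sum>z | z ^ m = 1. z ^ k) = (\<Sum>z | z ^ m = 1. (w * z) ^ k)"
    by (rule sum.reindex_bij_betw[symmetric])
  also have "\<dots> = w ^ k * (\<Sum>z | z ^ m = 1. z ^ k)"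
    by (simp add: power_mult_distrib sum_distrib_left)
  finally show ?thesis
    using \<open>w ^ k \<noteq> w ^ 0\<close> False by auto
qed

section \<open>Complex powers of q and uniqueness of the L-polynomial\<close>

lemma poly_abs_powr:
  fixes N :: "'a::finite_field poly"
  assumes "N \<in> monic_polys"
  shows "complex_of_real (poly_abs N) powr w = (of_nat CARD('a) powr w) ^ degree N"
proof -
  have "N \<noteq> 0"
    using assms by (auto simp: monic_polys_def)
  \<comment> \<open>Complex \<open>powr\<close> does not respect powers of the base in general; here
    the base is a positive real, so the principal logarithm is the real one and there is no branch
    problem.\<close>
  have ln_card: "ln (complex_of_nat CARD('a)) = of_real (ln (real CARD('a)))"
    using Ln_of_real[of "real CARD('a)"] by simp
  have "ln (complex_of_real (real CARD('a) ^ degree N)) = of_real (ln (real CARD('a) ^ degree N))"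
    by (rule Ln_of_real) simp
  also have "\<dots> = of_nat (degree N) * ln (of_nat CARD('a))"
    by (simp add: ln_realpow ln_card)
  finally have "complex_of_real (real CARD('a) ^ degree N) powr w
                  = exp (of_nat (degree N) * (w * ln (of_nat CARD('a))))"
    by (simp add: powr_def mult_ac)
  also have "\<dots> = (of_nat CARD('a) powr w) ^ degree N"
    unfolding exp_of_nat_mult by (simp add: powr_def)
  finally show ?thesis
    using \<open>N \<noteq> 0\<close> by (simp add: poly_abs_def)
qed

lemma norm_card_powr:
  "cmod (of_nat CARD('a::finite) powr w) = real CARD('a) powr Re w"
  using norm_powr_real_powr[of "of_nat CARD('a)" w] by simp

lemma card_finite_field_ge_2: "CARD('a::finite_field) \<ge> 2"
proof -
  have "card {0, 1 :: 'a} \<le> CARD('a)"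
    by (intro card_mono) auto
  then show ?thesis
    by simp
qed

text \<open>The points s = 2, 3, 4, ... already suffice: the values of q^(-s) there have distinct
  norms, so the difference has infinitely many roots. This gives the uniqueness behind
  \<open>THE\<close> in \<open>dirichlet_L_poly\<close>.\<close>

lemma poly_eqI_card_powr:
  fixes P P' :: "complex poly"
  assumes "\<And>s. Re s > 1 \<Longrightarrow>
    poly P (of_nat CARD('a::finite_field) powr (- s)) = poly P' (of_nat CARD('a) powr (- s))"
  shows "P = P'"
proof (rule ccontr)
  assume "P \<noteq> P'"
  define f where "f = (\<lambda>k::nat. complex_of_nat CARD('a) powr (- of_nat (k + 2)))"
  have "poly (P - P') (f k) = 0" for k
    using assms[of "of_nat (k + 2)"] by (simp add: f_def)
  then have "range f \<subseteq> {x. poly (P - P') x = 0}"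
    by blast
  then have "finite (range f)"
    using poly_roots_finite[of "P - P'"] \<open>P \<noteq> P'\<close> finite_subset by auto
  moreover have "inj f"
  proof (rule injI)
    fix j k
    assume "f j = f k"
    then have "cmod (f j) = cmod (f k)"
      by simp
    then show "j = k"
      using card_finite_field_ge_2[where 'a = 'a] powr_inj[of "real CARD('a)"]
      by (simp add: f_def norm_card_powr)
  qed
  ultimately show False
    using range_inj_infinite by blast
qed

section \<open>Residues modulo an irreducible polynomial\<close>

locale irreducible_modulus =
  fixes Q :: "'a::finite_field poly"
  assumes irreducible: "irreducible Q"
begin

lemma prime_elem_modulus: "prime_elem Q"
  using irreducible by (rule field_poly_irreducible_imp_prime)

lemma modulus_nonzero: "Q \<noteq> 0"
  using irreducible by auto

lemma degree_modulus_pos: "degree Q > 0"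
  using irreducible by (metis gr0I irreducible_not_unit is_unit_iff_degree modulus_nonzero)

lemma coprime_iff: "coprime A Q \<longleftrightarrow> \<not> Q dvd A"
proof
  assume "coprime A Q"
  then show "\<not> Q dvd A"
    using coprime_common_divisor[of A Q Q] irreducible_not_unit[OF irreducible] by auto
next
  assume "\<not> Q dvd A"
  then show "coprime A Q"
    using irreducibleD'[OF irreducible] dvd_trans by (intro coprimeI) blast
qed

lemma mod_eq_self_iff: "A mod Q = A \<longleftrightarrow> degree A < degree Q"
  using degree_mod_less[OF modulus_nonzero, of A] degree_modulus_pos mod_poly_less[of A Q] by auto

definition residues :: "'a poly set" where
  "residues = {R. degree R < degree Q}"

lemma residues_eq: "residues = {p. \<forall>i\<ge>degree Q. poly.coeff p i = 0}"
  using degree_modulus_pos by (auto simp: residues_def coeff_zero_ge_iff)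

lemma finite_residues: "finite residues"
  and card_residues: "card residues = CARD('a) ^ degree Q"
  using finite_card_polys_below unfolding residues_eq by blast+

lemma mod_in_residues [simp]: "A mod Q \<in> residues"
  using mod_eq_self_iff[of "A mod Q"] by (simp add: residues_def)

lemma residues_mod: "R \<in> residues \<Longrightarrow> R mod Q = R"
  by (simp add: residues_def mod_eq_self_iff)

lemma zero_in_residues [simp]: "0 \<in> residues" and one_in_residues [simp]: "1 \<in> residues"
  using degree_modulus_pos by (auto simp: residues_def)

lemma one_mod [simp]: "1 mod Q = 1"
  by (simp add: residues_mod)

lemma residues_not_dvd: "R \<in> residues \<Longrightarrow> R \<noteq> 0 \<Longrightarrow> \<not> Q dvd R"
  by (metis mod_eq_0_iff_dvd residues_mod)

text \<open>Since Q is prime, multiplication by A is injective on the finite set of residues, hence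
  surjective, and so attains 1.\<close>

lemma ex_inverse:
  assumes "\<not> Q dvd A"
  shows "\<exists>B\<in>residues. A * B mod Q = 1"
proof -
  have "inj_on (\<lambda>R. A * R mod Q) residues"
  proof (rule inj_onI)
    fix R S
    assume RS: "R \<in> residues" "S \<in> residues" and "A * R mod Q = A * S mod Q"
    then have "Q dvd A * (R - S)"
      by (simp add: mod_eq_dvd_iff algebra_simps)
    then have "Q dvd R - S"
      using assms prime_elem_modulus by (simp add: prime_elem_dvd_mult_iff)
    then show "R = S"
      using RS by (metis mod_eq_dvd_iff residues_mod)
  qed
  then have "(\<lambda>R. A * R mod Q) ` residues = residues"
    by (intro endo_inj_surj finite_residues) auto
  then have "1 \<in> (\<lambda>R. A * R mod Q) ` residues"
    by simp
  then show ?thesis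
    by auto
qed

definition group_size :: nat where
  "group_size = CARD('a) ^ degree Q - 1"

lemma card_nonzero_residues: "card (residues - {0}) = group_size"
  by (simp add: card_residues group_size_def card_Diff_subset finite_residues)

lemma group_size_pos: "group_size > 0"
  using card_finite_field_ge_2[where 'a = 'a] degree_modulus_pos one_less_power[of "CARD('a)" "degree Q"]
  by (simp add: group_size_def)

text \<open>The classes are the fibres of reduction modulo Q, so the invertible ones are indexed by
  the nonzero residues.\<close>

lemma poly_totient_eq: "poly_totient Q = group_size"
proof -
  let ?r = "{(A, B). Q dvd A - B}"
  have class_eq: "?r `` {A} = {B. B mod Q = A mod Q}" for A
    by (auto simp: mod_eq_dvd_iff dvd_diff_commute)
  have unit_iff: "(\<exists>B. Q dvd A * B - 1) \<longleftrightarrow> \<not> Q dvd A" for A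
  proof
    assume "\<exists>B. Q dvd A * B - 1"
    then show "\<not> Q dvd A"
      using irreducible_not_unit[OF irreducible] dvd_diff_right_iff[of Q _ 1] dvd_mult2[of Q A]
      by blast
  next
    assume "\<not> Q dvd A"
    then show "\<exists>B. Q dvd A * B - 1"
      using ex_inverse by (metis mod_eq_dvd_iff one_mod)
  qed
  have "{A. \<not> Q dvd A} // ?r = (\<lambda>A. {B. B mod Q = A}) ` (residues - {0})"
  proof (intro equalityI subsetI)
    fix X
    assume "X \<in> {A. \<not> Q dvd A} // ?r"
    then obtain A where "\<not> Q dvd A" "X = {B. B mod Q = A mod Q}"
      unfolding quotient_def class_eq by blast
    then show "X \<in> (\<lambda>A. {B. B mod Q = A}) ` (residues - {0})"
      by (intro image_eqI[where x = "A mod Q"]) (auto simp: dvd_eq_mod_eq_0)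
  next
    fix X
    assume "X \<in> (\<lambda>A. {B. B mod Q = A}) ` (residues - {0})"
    then obtain A where "A \<in> residues" "A \<noteq> 0" "X = {B. B mod Q = A mod Q}"
      by (auto simp: residues_mod)
    then show "X \<in> {A. \<not> Q dvd A} // ?r"
      unfolding quotient_def class_eq using residues_not_dvd by blast
  qed
  moreover have "inj_on (\<lambda>A. {B. B mod Q = A}) (residues - {0})"
    by (rule inj_onI) (metis (mono_tags) Diff_iff mem_Collect_eq residues_mod)
  ultimately show ?thesis
    by (simp add: poly_totient_def unit_iff card_image card_nonzero_residues)
qed

text \<open>Built on representatives to make the cyclicity of the multiplicative group of a finite
  field available. Addition needs no reduction, as sums of residues keep degree below
  \<open>degree Q\<close>.\<close>

definition residue_field :: "'a poly ring" where
  "residue_field = \<lparr>carrier = residues, monoid.mult = \<lambda>A B. A * B mod Q, one = 1, zero = 0, add = (+)\<rparr>"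

lemma residue_field_simps [simp]:
  "carrier residue_field = residues"
  "A \<otimes>\<^bsub>residue_field\<^esub> B = A * B mod Q"
  "\<one>\<^bsub>residue_field\<^esub> = 1"
  "\<zero>\<^bsub>residue_field\<^esub> = 0"
  "A \<oplus>\<^bsub>residue_field\<^esub> B = A + B"
  by (simp_all add: residue_field_def)

lemma field_residue_field: "field residue_field"
proof -
  have "cring residue_field"
  proof (rule cringI)
    show "abelian_group residue_field"
    proof (rule abelian_groupI)
      fix A
      assume "A \<in> carrier residue_field"
      then show "\<exists>B\<in>carrier residue_field. B \<oplus>\<^bsub>residue_field\<^esub> A = \<zero>\<^bsub>residue_field\<^esub>"
        by (intro bexI[where x = "- A"]) (auto simp: residues_def)
    qed (auto simp: residues_eq algebra_simps)
    show "comm_monoid residue_field"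
      by (rule comm_monoidI) (auto simp: residues_mod mod_simps mult_ac)
  qed (auto simp: mod_simps algebra_simps poly_mod_add_left)
  then show ?thesis
    using ex_inverse residues_not_dvd
    by (intro cring.cring_fieldI2) (auto simp: mod_simps)
qed

lemma residue_field_power: "A [^]\<^bsub>residue_field\<^esub> (n::nat) = A ^ n mod Q"
proof (induction n)
  case (Suc n)
  have "A [^]\<^bsub>residue_field\<^esub> Suc n = (A ^ n mod Q) * A mod Q"
    by (simp only: Group.nat_pow_Suc Suc residue_field_simps)
  then show ?case
    by (simp only: mod_mult_left_eq power_Suc2)
qed simp

lemma power_group_size:
  assumes "\<not> Q dvd A"
  shows "A ^ group_size mod Q = 1"
proof -
  have "A mod Q \<in> carrier (mult_of residue_field)"
    using assms by (simp add: dvd_eq_mod_eq_0)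
  then have "(A mod Q) [^]\<^bsub>mult_of residue_field\<^esub> Coset.order (mult_of residue_field)
               = \<one>\<^bsub>mult_of residue_field\<^esub>"
    by (rule group.pow_order_eq_1[OF field.field_mult_group[OF field_residue_field]])
  then have "(A mod Q) [^]\<^bsub>residue_field\<^esub> Coset.order (mult_of residue_field) = 1"
    by (simp only: nat_pow_mult_of one_mult_of residue_field_simps)
  then show ?thesis
    by (simp only: Coset.order_def carrier_mult_of residue_field_simps card_nonzero_residues
        residue_field_power power_mod)
qed

lemma power_mod_group_size:
  assumes "\<not> Q dvd A"
  shows "A ^ k mod Q = A ^ (k mod group_size) mod Q"
proof -
  have "A ^ k = (A ^ group_size) ^ (k div group_size) * A ^ (k mod group_size)"
    by (simp flip: power_mult power_add)
  then have "A ^ k mod Q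
               = ((A ^ group_size mod Q) ^ (k div group_size) mod Q) * A ^ (k mod group_size) mod Q"
    by (simp only: power_mod mod_mult_left_eq)
  then show ?thesis
    by (simp only: power_group_size[OF assms] power_one one_mod mult_1_left)
qed

text \<open>Reducing exponents modulo \<open>group_size\<close> turns a generator into a surjection
  from \<open>{..<group_size}\<close> onto a set of the same size. It is therefore injective, which
  gives uniqueness of the exponent.\<close>

lemma ex_generator:
  "\<exists>g. \<not> Q dvd g \<and>
     (\<forall>A. \<not> Q dvd A \<longrightarrow> (\<exists>!k. k < group_size \<and> g ^ k mod Q = A mod Q))"
proof -
  have "finite (carrier residue_field)"
    by (simp add: finite_residues)
  then obtain g where g: "g \<in> residues - {0}"
    and "residues - {0} = {g [^]\<^bsub>residue_field\<^esub> i | i::nat. i \<in> UNIV}"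
    using field.finite_field_mult_group_has_gen[OF field_residue_field]
    unfolding carrier_mult_of residue_field_simps by blast
  then have gen: "residues - {0} = range (\<lambda>k. g ^ k mod Q)"
    unfolding residue_field_power by (simp only: image_def simp_thms UNIV_I bex_UNIV)
  have g': "\<not> Q dvd g"
    using g residues_not_dvd by blast
  have surj: "(\<lambda>k. g ^ k mod Q) ` {..<group_size} = residues - {0}"
  proof
    show "residues - {0} \<subseteq> (\<lambda>k. g ^ k mod Q) ` {..<group_size}"
    proof
      fix R
      assume "R \<in> residues - {0}"
      then obtain k where k: "R = g ^ k mod Q"
        unfolding gen by blast
      have "k mod group_size \<in> {..<group_size}"
        using group_size_pos by simp
      then show "R \<in> (\<lambda>k. g ^ k mod Q) ` {..<group_size}"
        using trans[OF k power_mod_group_size[OF g']] by (rule rev_image_eqI)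
    qed
  qed (use gen in blast)
  then have inj: "inj_on (\<lambda>k. g ^ k mod Q) {..<group_size}"
    by (intro eq_card_imp_inj_on) (simp_all only: card_nonzero_residues finite_lessThan card_lessThan)
  have "\<exists>!k. k < group_size \<and> g ^ k mod Q = A mod Q" if "\<not> Q dvd A" for A
  proof -
    have "A mod Q \<in> residues - {0}"
      using that by (simp add: dvd_eq_mod_eq_0)
    then have "A mod Q \<in> (\<lambda>k. g ^ k mod Q) ` {..<group_size}"
      by (simp only: surj)
    then obtain k where "A mod Q = g ^ k mod Q" "k \<in> {..<group_size}"
      by (rule imageE)
    then show ?thesis
      by (intro ex1I[of _ k]) (auto dest: inj_onD[OF inj])
  qed
  then show ?thesis
    using g' by blast
qed

section \<open>Orthogonality of characters\<close>

definition generator :: "'a poly" where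
  "generator = (SOME g. \<not> Q dvd g \<and>
     (\<forall>A. \<not> Q dvd A \<longrightarrow> (\<exists>!k. k < group_size \<and> g ^ k mod Q = A mod Q)))"

text \<open>Unspecified when Q divides A; \<open>root_char\<close> tests divisibility before using
  it.\<close>

definition dlog :: "'a poly \<Rightarrow> nat" where
  "dlog A = (THE k. k < group_size \<and> generator ^ k mod Q = A mod Q)"

lemma generator_not_dvd: "\<not> Q dvd generator"
  and ex1_dlog: "\<not> Q dvd A \<Longrightarrow> \<exists>!k. k < group_size \<and> generator ^ k mod Q = A mod Q"
  using someI_ex[OF ex_generator] unfolding generator_def[symmetric] by blast+

lemma dlog:
  assumes "\<not> Q dvd A"
  shows "dlog A < group_size" "generator ^ dlog A mod Q = A mod Q"
  using theI'[OF ex1_dlog[OF assms]] unfolding dlog_def by blast+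

lemma dlog_eq:
  assumes "\<not> Q dvd A" "generator ^ k mod Q = A mod Q"
  shows "dlog A = k mod group_size"
proof -
  have "generator ^ (k mod group_size) mod Q = A mod Q"
    using power_mod_group_size[OF generator_not_dvd, of k] assms(2) by (rule trans[OF sym])
  moreover have "k mod group_size < group_size"
    using group_size_pos by simp
  ultimately show ?thesis
    unfolding dlog_def by (intro the1_equality ex1_dlog assms conjI)
qed

text \<open>\<open>dlog\<close> is additive only modulo \<open>group_size\<close>. A root of unity
  of that order cannot see the difference, and this is what makes \<open>root_char\<close>
  multiplicative.\<close>

lemma unity_root_power_dlog:
  assumes "\<not> Q dvd A" "generator ^ k mod Q = A mod Q" and z: "z ^ group_size = (1::complex)"
  shows "z ^ dlog A = z ^ k"
proof -
  have "z ^ k = (z ^ group_size) ^ (k div group_size) * z ^ (k mod group_size)"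
    by (simp flip: power_mult power_add)
  then show ?thesis
    by (simp add: z dlog_eq[OF assms(1,2)])
qed

definition root_char :: "complex \<Rightarrow> 'a poly \<Rightarrow> complex" where
  "root_char z A = (if Q dvd A then 0 else z ^ dlog A)"

lemma dirichlet_char_root_char:
  assumes z: "z ^ group_size = 1"
  shows "dirichlet_char Q (root_char z)"
  unfolding dirichlet_char_def coprime_iff
proof (intro conjI allI)
  fix A B
  have "dlog (A + B * Q) = dlog A"
    by (simp add: dlog_def)
  moreover have "Q dvd A + B * Q \<longleftrightarrow> Q dvd A"
    by (simp add: dvd_add_left_iff)
  ultimately show "root_char z (A + B * Q) = root_char z A"
    by (simp add: root_char_def)
  have dvd_iff: "Q dvd A * B \<longleftrightarrow> Q dvd A \<or> Q dvd B"
    by (rule prime_elem_dvd_mult_iff[OF prime_elem_modulus])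
  show "root_char z (A * B) = root_char z A * root_char z B"
  proof (cases "Q dvd A \<or> Q dvd B")
    case False
    have "generator ^ (dlog A + dlog B) mod Q
            = (generator ^ dlog A mod Q) * (generator ^ dlog B mod Q) mod Q"
      by (simp only: power_add mod_mult_eq)
    also have "\<dots> = (A mod Q) * (B mod Q) mod Q"
      using False dlog(2)[of A] dlog(2)[of B] by presburger
    also have "\<dots> = A * B mod Q"
      by (rule mod_mult_eq)
    finally have "z ^ dlog (A * B) = z ^ (dlog A + dlog B)"
      using False dvd_iff by (intro unity_root_power_dlog z) auto
    then show ?thesis
      using False dvd_iff by (simp add: root_char_def power_add)
  qed (use dvd_iff in \<open>auto simp: root_char_def\<close>)
  have "z \<noteq> 0"
    using z group_size_pos by (auto simp: power_0_left)
  then show "root_char z A \<noteq> 0 \<longleftrightarrow> \<not> Q dvd A"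
    by (simp add: root_char_def)
qed

section \<open>Structure of an arbitrary character\<close>

context
  fixes \<psi>
  assumes char: "dirichlet_char Q \<psi>"
begin

lemma char_mult: "\<psi> (A * B) = \<psi> A * \<psi> B"
  and char_eq_0_iff: "\<psi> A = 0 \<longleftrightarrow> Q dvd A"
  using char unfolding dirichlet_char_def coprime_iff by blast+

lemma char_mod: "\<psi> (A mod Q) = \<psi> A"
proof -
  have "\<psi> (A mod Q + (A div Q) * Q) = \<psi> (A mod Q)"
    using char unfolding dirichlet_char_def by blast
  then show ?thesis
    by simp
qed

lemma char_one: "\<psi> 1 = 1"
proof -
  have "\<psi> 1 \<noteq> 0"
    unfolding char_eq_0_iff by (rule irreducible_not_unit[OF irreducible])
  then show ?thesis
    using char_mult[of 1 1] by simp
qed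

lemma char_power: "\<psi> (A ^ n) = \<psi> A ^ n"
  by (induction n) (simp_all add: char_one char_mult)

lemma char_power_group_size:
  assumes "\<not> Q dvd A"
  shows "\<psi> A ^ group_size = 1"
  using char_mod[of "A ^ group_size"] power_group_size[OF assms] by (simp add: char_power char_one)

text \<open>Each value is 0 or a root of unity. This is the bound B = 1 for
  \<open>abs_summable_on_monic\<close>.\<close>

lemma norm_char_le: "cmod (\<psi> A) \<le> 1"
proof (cases "Q dvd A")
  case True
  then have "\<psi> A = 0"
    by (simp only: char_eq_0_iff)
  then show ?thesis
    by simp
next
  case False
  have "cmod (\<psi> A) ^ group_size = 1"
    using char_power_group_size[OF False] by (simp flip: norm_power)
  then show ?thesis
    using one_less_power[of "cmod (\<psi> A)" group_size] group_size_pos by force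
qed

text \<open>A character depends only on residues, and every unit is congruent to a power of the
  generator, so the value at the generator determines it.\<close>

lemma char_eq_root_char: "\<psi> = root_char (\<psi> generator)"
proof
  fix A
  show "\<psi> A = root_char (\<psi> generator) A"
  proof (cases "Q dvd A")
    case True
    then have "\<psi> A = 0"
      by (simp only: char_eq_0_iff)
    with True show ?thesis
      by (simp add: root_char_def)
  next
    case False
    have "\<psi> A = \<psi> (generator ^ dlog A mod Q)"
      by (simp only: dlog[OF False] char_mod)
    with False show ?thesis
      by (simp only: char_mod char_power root_char_def if_False)
  qed
qed

end

lemma dirichlet_chars_eq: "{\<psi>. dirichlet_char Q \<psi>} = root_char ` {z. z ^ group_size = 1}"
proof (intro equalityI subsetI)
  fix \<psi>
  assume "\<psi> \<in> {\<psi>. dirichlet_char Q \<psi>}"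
  then have char: "dirichlet_char Q \<psi>"
    by simp
  then have "\<psi> generator \<in> {z. z ^ group_size = 1}"
    using char_power_group_size generator_not_dvd by blast
  with char_eq_root_char[OF char] show "\<psi> \<in> root_char ` {z. z ^ group_size = 1}"
    by (rule image_eqI)
qed (use dirichlet_char_root_char in auto)

text \<open>Evaluation at the generator recovers z. The exponent 1 is compared through
  \<open>unity_root_power_dlog\<close>, because \<open>dlog generator\<close> is 0, not 1, when
  \<open>group_size\<close> is 1.\<close>

lemma inj_on_root_char: "inj_on root_char {z. z ^ group_size = 1}"
proof (rule inj_on_inverseI)
  fix z :: complex
  assume "z \<in> {z. z ^ group_size = 1}"
  then show "root_char z generator = z"
    using unity_root_power_dlog[OF generator_not_dvd, of 1 z] generator_not_dvd
    by (simp add: root_char_def)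
qed

lemma finite_dirichlet_chars: "finite {\<psi>. dirichlet_char Q \<psi>}"
  unfolding dirichlet_chars_eq using group_size_pos by (intro finite_imageI finite_roots_unity) simp

text \<open>For a unit A this is the sum of \<open>z ^ dlog A\<close> over the roots of unity, and
  \<open>dlog A = 0\<close> exactly when A is 1 modulo Q.\<close>

lemma sum_dirichlet_chars:
  "(\<Sum>\<psi> | dirichlet_char Q \<psi>. \<psi> A) = (if A mod Q = 1 then of_nat group_size else 0)"
proof (cases "Q dvd A")
  case True
  then have "(\<Sum>\<psi> | dirichlet_char Q \<psi>. \<psi> A) = 0"
    by (intro sum.neutral) (simp add: char_eq_0_iff)
  with True show ?thesis
    by (simp add: mod_eq_0_iff_dvd[symmetric])
next
  case False
  have "(\<Sum>\<psi> | dirichlet_char Q \<psi>. \<psi> A) = (\<Sum>z | z ^ group_size = 1. z ^ dlog A)"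
    unfolding dirichlet_chars_eq using False
    by (simp add: sum.reindex[OF inj_on_root_char] root_char_def)
  also have "\<dots> = (if dlog A = 0 then of_nat group_size else 0)"
    by (rule sum_roots_unity_power) (rule dlog[OF False])
  also have "dlog A = 0 \<longleftrightarrow> A mod Q = 1"
    using dlog(2)[OF False] dlog_eq[OF False, of 0] by auto
  finally show ?thesis .
qed

lemma dirichlet_char_trivial: "dirichlet_char Q (trivial_char Q)"
proof -
  have "trivial_char Q = root_char 1"
    by (simp add: fun_eq_iff trivial_char_def root_char_def coprime_iff)
  then show ?thesis
    by (simp add: dirichlet_char_root_char)
qed

section \<open>The mean value\<close>

text \<open>For \<open>\<psi> A \<noteq> 1\<close>, replacing the residue of \<open>N\<close> modulo \<open>Q\<close> by that of \<open>A * N\<close> permutes the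
  monic polynomials of each degree \<open>\<ge> degree Q\<close> and multiplies the sum by \<open>\<psi> A\<close>.\<close>

lemma infsum_nontrivial_char_tail:
  assumes char: "dirichlet_char Q \<psi>" and nontrivial: "\<psi> \<noteq> trivial_char Q"
  shows "(\<Sum>\<^sub>\<infinity>N \<in> {N \<in> monic_polys. degree N \<ge> degree Q}. \<psi> N * t ^ degree N) = 0"
proof -
  let ?T = "{N \<in> monic_polys :: 'a poly set. degree N \<ge> degree Q}"
  let ?S = "\<Sum>\<^sub>\<infinity>N \<in> ?T. \<psi> N * t ^ degree N"
  \<comment> \<open>Both characters vanish on the multiples of Q, so a point where they differ is a
    unit.\<close>
  obtain A where "\<psi> A \<noteq> trivial_char Q A"
    using nontrivial by blast
  then have A: "\<psi> A \<noteq> 1" "\<not> Q dvd A"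
    using char_eq_0_iff[OF char, of A] by (auto simp: trivial_char_def coprime_iff split: if_splits)
  obtain B where AB: "A * B mod Q = 1"
    using ex_inverse[OF A(2)] by blast
  define \<sigma> where "\<sigma> = (\<lambda>C N. N - N mod Q + C * N mod Q)"
  have \<sigma>_apply: "\<sigma> C N = N - N mod Q + C * N mod Q" for C N
    by (simp add: \<sigma>_def)
  have \<sigma>_mod: "\<sigma> C N mod Q = C * N mod Q" for C N
    by (simp add: \<sigma>_def minus_mod_eq_mult_div)
  \<comment> \<open>The map alters only coefficients below \<open>degree Q\<close>; on the tail this
    leaves the degree and the leading coefficient intact.\<close>
  have degree_change: "degree (- (N mod Q) + C * N mod Q) < degree Q" for C N
  proof -
    have "- (N mod Q) + C * N mod Q \<in> residues"
      using mod_in_residues[of N] mod_in_residues[of "C * N"] unfolding residues_eq by simp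
    then show ?thesis
      by (simp add: residues_def)
  qed
  have \<sigma>_eq: "\<sigma> C N = N + (- (N mod Q) + C * N mod Q)" for C N
    by (simp add: \<sigma>_def)
  have \<sigma>_T: "\<sigma> C N \<in> ?T" and degree_\<sigma>: "degree (\<sigma> C N) = degree N" if "N \<in> ?T" for C N
  proof -
    have less: "degree (- (N mod Q) + C * N mod Q) < degree N"
      using degree_change[of N C] that by simp
    show "degree (\<sigma> C N) = degree N"
      unfolding \<sigma>_eq by (rule degree_add_eq_left[OF less])
    moreover have "lead_coeff (\<sigma> C N) = lead_coeff N"
      using lead_coeff_add_le[OF less] unfolding \<sigma>_eq by (simp only: add.commute[of N])
    ultimately show "\<sigma> C N \<in> ?T"
      using that by (simp add: monic_polys_def)
  qed
  have \<sigma>_inverse: "\<sigma> C' (\<sigma> C N) = N" if "C' * C mod Q = 1" for C C' N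
  proof -
    have "C' * \<sigma> C N mod Q = C' * (\<sigma> C N mod Q) mod Q"
      by (rule mod_mult_right_eq[symmetric])
    also have "\<dots> = (C' * C mod Q) * N mod Q"
      by (simp only: \<sigma>_mod mod_mult_right_eq mod_mult_left_eq mult.assoc)
    finally have "C' * \<sigma> C N mod Q = N mod Q"
      by (simp only: that mult_1_left)
    then have "\<sigma> C' (\<sigma> C N) = \<sigma> C N - C * N mod Q + N mod Q"
      using \<sigma>_apply[of C' "\<sigma> C N"] by (simp only: \<sigma>_mod[of C N])
    then show ?thesis
      using \<sigma>_apply[of C N] by simp
  qed
  have BA: "B * A mod Q = 1"
    using AB by (simp only: mult.commute)
  have "bij_betw (\<sigma> A) ?T ?T"
    by (rule bij_betw_byWitness[where f' = "\<sigma> B"])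
      (use \<sigma>_T in \<open>blast intro: \<sigma>_inverse[OF AB] \<sigma>_inverse[OF BA]\<close>)+
  \<comment> \<open>This holds for every \<open>t\<close>: a divergent \<open>infsum\<close> is 0,
    and both reindexing and scaling respect that convention.\<close>
  then have "?S = (\<Sum>\<^sub>\<infinity>N \<in> ?T. \<psi> (\<sigma> A N) * t ^ degree (\<sigma> A N))"
    by (rule infsum_reindex_bij_betw[symmetric])
  also have "\<dots> = (\<Sum>\<^sub>\<infinity>N \<in> ?T. \<psi> A * (\<psi> N * t ^ degree N))"
  proof (rule infsum_cong)
    fix N
    assume N: "N \<in> ?T"
    have "\<psi> (\<sigma> A N) = \<psi> (A * N mod Q)"
      using char_mod[OF char, of "\<sigma> A N"] by (simp only: \<sigma>_mod)
    then have "\<psi> (\<sigma> A N) = \<psi> (A * N)"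
      by (simp only: char_mod[OF char])
    then show "\<psi> (\<sigma> A N) * t ^ degree (\<sigma> A N) = \<psi> A * (\<psi> N * t ^ degree N)"
      by (simp add: degree_\<sigma>[OF N] char_mult[OF char])
  qed
  also have "\<dots> = \<psi> A * ?S"
    by (rule infsum_cmult_right')
  finally show ?thesis
    using A(1) by simp
qed

lemma dirichlet_L_series_eq:
  assumes char: "dirichlet_char Q \<psi>" and nontrivial: "\<psi> \<noteq> trivial_char Q" and s: "Re s > 1"
  shows "dirichlet_L_series \<psi> s =
    (\<Sum>N \<in> {N \<in> monic_polys. degree N < degree Q}. \<psi> N * (of_nat CARD('a) powr (- s)) ^ degree N)"
proof -
  define t where "t = complex_of_nat CARD('a) powr (- s)"
  let ?H = "{N \<in> monic_polys :: 'a poly set. degree N < degree Q}"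
  let ?T = "{N \<in> monic_polys :: 'a poly set. degree N \<ge> degree Q}"
  have "real CARD('a) * cmod t = real CARD('a) powr (1 - Re s)"
    unfolding t_def norm_card_powr by (simp add: powr_diff powr_minus divide_inverse)
  also have "\<dots> < 1"
    using s card_finite_field_ge_2[where 'a = 'a] by (intro powr_less_one) auto
  finally have "(\<lambda>N. \<psi> N * t ^ degree N) summable_on monic_polys"
    by (rule abs_summable_summable[OF abs_summable_on_monic[OF norm_char_le[OF char]]])
  then have summable: "(\<lambda>N. \<psi> N * t ^ degree N) summable_on ?T"
    by (rule summable_on_subset) auto
  have "dirichlet_L_series \<psi> s = (\<Sum>\<^sub>\<infinity>N \<in> ?H \<union> ?T. \<psi> N * t ^ degree N)"
    unfolding dirichlet_L_series_def by (intro infsum_cong_neutral) (auto simp: poly_abs_powr t_def)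
  also have "\<dots> = infsum (\<lambda>N. \<psi> N * t ^ degree N) ?H + infsum (\<lambda>N. \<psi> N * t ^ degree N) ?T"
    by (intro infsum_Un_disjoint summable summable_on_finite finite_monic_degree_less) auto
  also have "\<dots> = (\<Sum>N \<in> ?H. \<psi> N * t ^ degree N)"
    using infsum_nontrivial_char_tail[OF char nontrivial] by (simp add: finite_monic_degree_less)
  finally show ?thesis
    by (simp add: t_def)
qed

text \<open>Existence for \<open>THE\<close> comes from \<open>dirichlet_L_series_eq\<close>,
  uniqueness from \<open>poly_eqI_card_powr\<close>; the formula then holds at every s, including
  1/2.\<close>

lemma dirichlet_L_eq:
  assumes char: "dirichlet_char Q \<psi>" and nontrivial: "\<psi> \<noteq> trivial_char Q"
  shows "dirichlet_L s \<psi> =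
    (\<Sum>N \<in> {N \<in> monic_polys. degree N < degree Q}. \<psi> N * (of_nat CARD('a) powr (- s)) ^ degree N)"
proof -
  define P where
    "P = (\<Sum>N \<in> {N \<in> monic_polys. degree N < degree Q}. Polynomial.monom (\<psi> N) (degree N))"
  have P: "poly P x = (\<Sum>N \<in> {N \<in> monic_polys. degree N < degree Q}. \<psi> N * x ^ degree N)" for x
    by (simp add: P_def poly_sum poly_monom)
  have "dirichlet_L_poly \<psi> = P"
    unfolding dirichlet_L_poly_def
  proof (rule the_equality)
    show "\<forall>s. Re s > 1 \<longrightarrow> dirichlet_L_series \<psi> s = poly P (of_nat CARD('a) powr (- s))"
      by (simp add: P dirichlet_L_series_eq[OF char nontrivial])
  next
    fix P'
    assume "\<forall>s. Re s > 1 \<longrightarrow> dirichlet_L_series \<psi> s = poly P' (of_nat CARD('a) powr (- s))"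
    then show "P' = P"
      by (intro poly_eqI_card_powr[where 'a = 'a])
        (simp add: P dirichlet_L_series_eq[OF char nontrivial, symmetric])
  qed
  then show ?thesis
    by (simp add: dirichlet_L_def P)
qed

section \<open>Averaging over the nontrivial characters\<close>

lemma sum_dirichlet_L:
  "(\<Sum>\<psi> \<in> {\<psi>. dirichlet_char Q \<psi>} - {trivial_char Q}. dirichlet_L s \<psi>)
     = of_nat group_size - (\<Sum>k<degree Q. (of_nat CARD('a) * of_nat CARD('a) powr (- s)) ^ k)"
proof -
  let ?t = "complex_of_nat CARD('a) powr (- s)"
  let ?H = "{N \<in> monic_polys :: 'a poly set. degree N < degree Q}"
  let ?X = "{\<psi>. dirichlet_char Q \<psi>}"
  have H_not_dvd: "\<not> Q dvd N" and H_mod: "N mod Q = N" if "N \<in> ?H" for N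
  proof -
    have "N \<in> residues" "N \<noteq> 0"
      using that by (auto simp: residues_def monic_polys_def)
    then show "\<not> Q dvd N" "N mod Q = N"
      using residues_not_dvd residues_mod by blast+
  qed
  have "(\<Sum>\<psi> \<in> ?X - {trivial_char Q}. dirichlet_L s \<psi>)
      = (\<Sum>\<psi> \<in> ?X - {trivial_char Q}. \<Sum>N\<in>?H. \<psi> N * ?t ^ degree N)"
    by (intro sum.cong refl dirichlet_L_eq) auto
  \<comment> \<open>Now that only finite sums remain, the trivial character can be included and its
    truncated sum subtracted.\<close>
  also have "\<dots> = (\<Sum>\<psi> \<in> ?X. \<Sum>N\<in>?H. \<psi> N * ?t ^ degree N)
                    - (\<Sum>N\<in>?H. trivial_char Q N * ?t ^ degree N)"
    by (simp add: sum_diff1 finite_dirichlet_chars dirichlet_char_trivial)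
  also have "(\<Sum>N\<in>?H. trivial_char Q N * ?t ^ degree N) = (\<Sum>N\<in>?H. ?t ^ degree N)"
    by (intro sum.cong refl) (simp add: trivial_char_def coprime_iff H_not_dvd)
  also have "\<dots> = (\<Sum>k<degree Q. (of_nat CARD('a) * ?t) ^ k)"
    by (rule sum_monic_degree_less)
  also have "(\<Sum>\<psi> \<in> ?X. \<Sum>N\<in>?H. \<psi> N * ?t ^ degree N)
           = (\<Sum>N\<in>?H. (\<Sum>\<psi> | dirichlet_char Q \<psi>. \<psi> N) * ?t ^ degree N)"
    by (subst sum.swap) (simp add: sum_distrib_right)
  \<comment> \<open>A polynomial in \<open>?H\<close> is its own residue, so it is 1 modulo Q only
    if it equals 1; there the power of \<open>?t\<close> has exponent 0.\<close>
  also have "\<dots> = (\<Sum>N\<in>?H. if N = 1 then of_nat group_size else 0)"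
    by (intro sum.cong refl) (auto simp: sum_dirichlet_chars H_mod)
  also have "\<dots> = of_nat group_size"
  proof -
    have "1 \<in> ?H"
      using degree_modulus_pos by (simp add: monic_polys_def)
    then show ?thesis
      by (simp only: sum.delta[OF finite_monic_degree_less] if_True)
  qed
  finally show ?thesis .
qed

text \<open>With r = sqrt q and d = \<open>degree Q\<close>, the subtracted sum is (r^d - 1) / (r -
  1) and phi(Q) = (r^d - 1) (r^d + 1). The factor r^d - 1 cancels, leaving 1 / ((r - 1) (r^d + 1))
  as the absolute error.\<close>

lemma mean_L_bound:
  "cmod (1 / of_nat (poly_totient Q) *
      (\<Sum>\<psi> \<in> {\<psi>. dirichlet_char Q \<psi>} - {trivial_char Q}. dirichlet_L (1 / 2) \<psi>) - 1)
     \<le> 1 / (sqrt CARD('a) - 1) * real CARD('a) powr (- (real (degree Q) - 1) / 2)"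
proof -
  define r where "r = sqrt CARD('a)"
  define d where "d = degree Q"
  define S where "S = (\<Sum>k<d. r ^ k)"
  have r: "r > 1" "r ^ 2 = real CARD('a)"
    using card_finite_field_ge_2[where 'a = 'a] by (auto simp: r_def)
  have r_powr: "real CARD('a) powr (1 / 2) = r"
    unfolding r_def by (rule powr_half_sqrt) simp
  have "real CARD('a) powr (- (1 / 2)) = 1 / r"
    unfolding powr_minus_divide r_powr by (rule refl)
  then have u: "complex_of_nat CARD('a) powr (- (1 / 2)) = of_real (1 / r)"
    using powr_of_real[of "real CARD('a)" "- (1 / 2)"] by simp
  have "real CARD('a) * (1 / r) = r"
    unfolding r(2)[symmetric] using r(1) by (simp add: power2_eq_square)
  then have "complex_of_real (real CARD('a) * (1 / r)) = of_real r"
    by (rule arg_cong)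
  then have t: "of_nat CARD('a) * complex_of_nat CARD('a) powr (- (1 / 2)) = of_real r"
    unfolding u by (simp only: of_real_mult of_real_of_nat_eq)
  have group_size: "real group_size = (r ^ d - 1) * (r ^ d + 1)"
  proof -
    have "real group_size = (r ^ 2) ^ d - 1"
      using group_size_pos unfolding r(2) by (simp add: group_size_def of_nat_diff d_def)
    then show ?thesis
      by (simp add: algebra_simps flip: power_mult power_add mult_2)
  qed
  have S: "S = (r ^ d - 1) / (r - 1)"
    using r by (simp add: S_def geometric_sum)
  have "r ^ d > 1"
    using r degree_modulus_pos by (simp add: d_def one_less_power)
  have "1 / of_nat (poly_totient Q) *
      (\<Sum>\<psi> \<in> {\<psi>. dirichlet_char Q \<psi>} - {trivial_char Q}. dirichlet_L (1 / 2) \<psi>) - 1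
      = 1 / of_nat group_size * (of_nat group_size - of_real S) - (1::complex)"
    by (simp add: sum_dirichlet_L poly_totient_eq t S_def d_def)
  also have "\<dots> = of_real (- (S / real group_size))"
    using group_size_pos by (simp add: field_simps)
  finally have "cmod (1 / of_nat (poly_totient Q) *
      (\<Sum>\<psi> \<in> {\<psi>. dirichlet_char Q \<psi>} - {trivial_char Q}. dirichlet_L (1 / 2) \<psi>) - 1)
      = \<bar>S / real group_size\<bar>"
    by (simp only: norm_of_real abs_minus)
  also have "S / real group_size = 1 / (r - 1) * (1 / (r ^ d + 1))"
    using r \<open>r ^ d > 1\<close> by (simp add: S group_size)
  also have "\<bar>\<dots>\<bar> = 1 / (r - 1) * (1 / (r ^ d + 1))"
    using r \<open>r ^ d > 1\<close> by simp
  \<comment> \<open>The target is r^(-(d - 1)), as the bound is phrased with d - 1; this gives away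
    more than a factor r.\<close>
  also have "\<dots> \<le> 1 / (r - 1) * (1 / r ^ (d - 1))"
  proof -
    have "r ^ (d - 1) \<le> r ^ d"
      using r by (intro power_increasing) auto
    then have "r ^ (d - 1) \<le> r ^ d + 1"
      by simp
    then show ?thesis
      using r by (intro mult_left_mono divide_left_mono) (auto simp: add_pos_pos)
  qed
  also have "1 / r ^ (d - 1) = real CARD('a) powr (- (real d - 1) / 2)"
  proof -
    have "r ^ (d - 1) = r powr real (d - 1)"
      using r(1) by (simp add: powr_realpow)
    also have "\<dots> = real CARD('a) powr (1 / 2 * real (d - 1))"
      unfolding r_powr[symmetric] by (rule powr_powr)
    also have "1 / 2 * real (d - 1) = (real d - 1) / 2"
      using degree_modulus_pos by (simp add: of_nat_diff d_def)
    finally show ?thesis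
      by (simp only: powr_minus_divide minus_divide_left[symmetric])
  qed
  finally show ?thesis
    by (simp only: r_def d_def)
qed

end

theorem proposition4p1:
  shows "\<exists>C::real. \<forall>Q :: 'a::finite_field poly. irreducible Q \<longrightarrow>
    (let D = real (degree Q) - 1 in
      cmod (1 / of_nat (poly_totient Q) *
              (\<Sum>\<psi> \<in> {\<psi>. dirichlet_char Q \<psi>} - {trivial_char Q}. dirichlet_L (1 / 2) \<psi>) - 1)
        \<le> C * real CARD('a) powr (- D / 2))"
  unfolding Let_def
  by (intro exI allI impI) (rule irreducible_modulus.mean_L_bound[OF irreducible_modulus.intro])

end
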